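(* For every fixed positive integer $k$ there is a constant $C=C(k)>0$ such that for all integers $n\ge 2$, $$(n!)^{1/k-C/\log n}\le M_k(S_n)\le (n!)^{1/k+C/\log n},$$ i.e. $M_k(S_n)=(n!)^{1/k+O(1/\log n)}$.
   Context: For a group $\Gamma$, a set $A\subseteq\Gamma$ is an $S_k$-set if whenever $\alpha_1\cdots\alpha_k=\beta_1\cdots\beta_k$ with all $\alpha_i,\beta_i\in A$, we have $(\alpha_1,\ldots,\alpha_k)=(\beta_1,\ldots,\beta_k)$. $M_k(\Gamma)$ denotes the maximum size of an $S_k$-set in $\Gamma$. $S_n$ is the symmetric group on $n$ letters. *)

theory Defs
  imports Complex_Main "HOL-Algebra.Sym_Groups"
begin

text \<open>
  A \<open>k\<close>-tuple of group elements is a list of length \<open>k\<close>; the \<open>foldr\<close> is the product of its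
  entries in the order of the list.
\<close>

definition S_set :: "('a, 'b) monoid_scheme \<Rightarrow> nat \<Rightarrow> 'a set \<Rightarrow> bool" where
  "S_set G k A \<longleftrightarrow> A \<subseteq> carrier G \<and>
     (\<forall>as bs. length as = k \<and> length bs = k \<and> set as \<subseteq> A \<and> set bs \<subseteq> A \<and>
        foldr (\<otimes>\<^bsub>G\<^esub>) as \<one>\<^bsub>G\<^esub> = foldr (\<otimes>\<^bsub>G\<^esub>) bs \<one>\<^bsub>G\<^esub> \<longrightarrow> as = bs)"

text \<open>Only meaningful when the carrier of \<open>G\<close> is finite; see \<open>max_S_set_attained\<close>.\<close>

definition max_S_set :: "nat \<Rightarrow> ('a, 'b) monoid_scheme \<Rightarrow> nat" where
  "max_S_set k G = Max (card ` {A. S_set G k A})"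

lemma finite_S_sets: "finite (carrier G) \<Longrightarrow> finite {A. S_set G k A}"
  by (rule finite_subset[of _ "Pow (carrier G)"]) (auto simp: S_set_def)

lemma S_set_empty: "S_set G k {}"
  by (auto simp: S_set_def)

lemma max_S_set_attained:
  assumes "finite (carrier G)"
  shows "\<exists>A. S_set G k A \<and> card A = max_S_set k G"
proof -
  have "max_S_set k G \<in> card ` {A. S_set G k A}"
    unfolding max_S_set_def
    using finite_S_sets[OF assms] S_set_empty by (intro Max_in) auto
  then show ?thesis by auto
qed

lemma card_le_max_S_set:
  assumes "finite (carrier G)" "S_set G k A"
  shows "card A \<le> max_S_set k G"
  unfolding max_S_set_def using finite_S_sets[OF assms(1)] assms(2) by (intro Max_ge) auto

end

theory Submission
  imports Defs
begin

text \<open>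
  Counting products of \<open>k\<close>-tuples gives \<open>(card A) ^ k \<le> n!\<close> for every \<open>S\<^sub>k\<close>-set \<open>A\<close>. For the
  lower bound put \<open>m = n div k\<close>, cut \<open>k * m\<close> of the \<open>n\<close> points into \<open>k\<close> blocks of size \<open>m\<close>, and let
  \<open>\<sigma>\<close> be the cyclic shift of the blocks. For permutations \<open>p\<^sub>1, \<dots>, p\<^sub>k\<close> of the first block, the
  product \<open>(\<sigma> p\<^sub>1) \<dots> (\<sigma> p\<^sub>k)\<close> acts on the \<open>k\<close> blocks separately, on each one by a translate of a
  different \<open>p\<^sub>i\<close>, so it determines all of them. Hence \<open>{\<sigma> p}\<close> is an \<open>S\<^sub>k\<close>-set of size \<open>m!\<close>, and
  \<open>(m!) ^ k\<close> agrees with \<open>n!\<close> up to a factor exponential in \<open>n\<close>.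
\<close>

text \<open>The \<open>S_set\<close> condition is injectivity of the product map on the
  \<open>card A ^ k\<close> lists.\<close>

lemma S_set_card_power_le:
  assumes G: "monoid G" "finite (carrier G)" and A: "S_set G k A"
  shows "card A ^ k \<le> card (carrier G)"
proof -
  interpret monoid G by (rule G(1))
  let ?L = "{xs. set xs \<subseteq> A \<and> length xs = k}"
  let ?f = "\<lambda>xs. foldr (\<otimes>\<^bsub>G\<^esub>) xs \<one>\<^bsub>G\<^esub>"
  have AG: "A \<subseteq> carrier G" using A by (simp add: S_set_def)
  have clo: "?f xs \<in> carrier G" if "set xs \<subseteq> A" for xs
    using that AG by (induction xs) auto
  have "inj_on ?f ?L"
    using A by (auto simp: inj_on_def S_set_def)
  moreover have "?f ` ?L \<subseteq> carrier G" using clo by auto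
  ultimately have "card ?L \<le> card (carrier G)"
    using G(2) card_inj_on_le by blast
  moreover have "card ?L = card A ^ k"
    using finite_subset[OF AG G(2)] by (rule card_lists_length_eq)
  ultimately show ?thesis by simp
qed

section \<open>Products of maps that agree with \<open>s\<close> off \<open>B\<close>\<close>

text \<open>Each factor merely advances the orbit of \<open>y\<close> by one step until it comes
  back to \<open>B\<close>. The start \<open>g z\<close> is left general so that the lemma applies
  on both sides of a chosen factor.\<close>

lemma foldr_comp_eq_funpow:
  assumes off: "\<And>a x. a \<in> set as \<Longrightarrow> x \<notin> B \<Longrightarrow> a x = s x"
    and orbit: "\<And>i. 0 < i \<Longrightarrow> i < k \<Longrightarrow> (s ^^ i) y \<notin> B"
    and "g z = (s ^^ j) y" "0 < j" "j + length as \<le> k"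
  shows "foldr (\<circ>) as g z = (s ^^ (j + length as)) y"
  using off assms(3-5)
proof (induction as)
  case (Cons a as)
  then have "foldr (\<circ>) as g z = (s ^^ (j + length as)) y" by (intro Cons.IH) auto
  then have "foldr (\<circ>) (a # as) g z = a ((s ^^ (j + length as)) y)" by simp
  also have "\<dots> = s ((s ^^ (j + length as)) y)"
    using Cons.prems orbit by (intro Cons.prems(1)) auto
  finally show ?case unfolding list.size add_Suc_right funpow.simps comp_apply by simp
qed simp

text \<open>The point \<open>(s ^^ Suc i) y\<close> is timed to complete its period just when factor
  \<open>i\<close> acts, so this is the only factor that meets it inside \<open>B\<close>. The
  remaining \<open>i\<close> factors on the left then push \<open>s x\<close> along the orbit of
  \<open>x\<close>.\<close>

lemma foldr_comp_at_orbit: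
  assumes off: "\<And>a x. a \<in> set as \<Longrightarrow> x \<notin> B \<Longrightarrow> a x = s x"
    and orbit: "\<And>j y. y \<in> B \<Longrightarrow> 0 < j \<Longrightarrow> j < k \<Longrightarrow> (s ^^ j) y \<notin> B"
    and period: "\<And>y. y \<in> B \<Longrightarrow> (s ^^ k) y = y"
    and as: "length as = k" "i < k" and y: "y \<in> B" "x \<in> B" "(as ! i) y = s x"
  shows "foldr (\<circ>) as id ((s ^^ Suc i) y) = (s ^^ Suc i) x"
proof -
  let ?z = "(s ^^ Suc i) y"
  let ?g = "foldr (\<circ>) (drop (Suc i) as) id"
  have split: "as = take i as @ as ! i # drop (Suc i) as"
    using as by (simp add: id_take_nth_drop)
  have "?g ?z = (s ^^ (Suc i + length (drop (Suc i) as))) y"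
    using as orbit[OF y(1)] off in_set_dropD[of _ "Suc i" as]
    by (intro foldr_comp_eq_funpow[where B = B and k = k]) auto
  also have "\<dots> = y" using as period[OF y(1)] by simp
  \<comment> \<open>Factor \<open>i\<close> itself includes one application of \<open>s\<close>, so
    the second walk starts at step 1, already outside \<open>B\<close> or at the end of its
    period.\<close>
  finally have "(as ! i \<circ> ?g) ?z = (s ^^ 1) x" using y(3) by simp
  then have "foldr (\<circ>) (take i as) (as ! i \<circ> ?g) ?z = (s ^^ (1 + length (take i as))) x"
    using as orbit[OF y(2)] off in_set_takeD[of _ i as]
    by (intro foldr_comp_eq_funpow[where B = B and k = k]) auto
  moreover have "foldr (\<circ>) as id = foldr (\<circ>) (take i as) (as ! i \<circ> ?g)"
    by (subst split) simp
  ultimately show ?thesis using as by simp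
qed

text \<open>Evaluated at \<open>(s ^^ Suc i) y\<close>, the two products give
  \<open>(s ^^ Suc i) (p y)\<close> and \<open>(s ^^ Suc i) (q y)\<close>; injectivity of
  \<open>s\<close> then gives \<open>p y = q y\<close>.\<close>

lemma S_set_shifted_permutations:
  assumes s: "s permutes {1..n}" and B: "B \<subseteq> {1..n}"
    and orbit: "\<And>j y. y \<in> B \<Longrightarrow> 0 < j \<Longrightarrow> j < k \<Longrightarrow> (s ^^ j) y \<notin> B"
    and period: "\<And>y. y \<in> B \<Longrightarrow> (s ^^ k) y = y"
  shows "S_set (sym_group n) k ((\<circ>) s ` {p. p permutes B})" (is "S_set _ _ ?A")
  unfolding S_set_def
proof (intro conjI allI impI)
  show "?A \<subseteq> carrier (sym_group n)"
    using s B by (auto simp: sym_group_def intro: permutes_compose permutes_subset)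
next
  fix as bs
  assume H: "length as = k \<and> length bs = k \<and> set as \<subseteq> ?A \<and> set bs \<subseteq> ?A \<and>
    foldr (\<otimes>\<^bsub>sym_group n\<^esub>) as \<one>\<^bsub>sym_group n\<^esub> = foldr (\<otimes>\<^bsub>sym_group n\<^esub>) bs \<one>\<^bsub>sym_group n\<^esub>"
  then have eq: "foldr (\<circ>) as id = foldr (\<circ>) bs id" by (simp add: sym_group_def)
  have off: "a x = s x" if "a \<in> ?A" "x \<notin> B" for a x
    using that by (auto simp: permutes_not_in)
  have inj: "inj (s ^^ j)" for j
    using permutes_inj[OF s] by (rule inj_fn)
  show "as = bs"
  proof (rule nth_equalityI)
    show "length as = length bs" using H by simp
  next
    fix i assume "i < length as"
    with H have i: "i < k" "length as = k" "length bs = k"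
      "as ! i \<in> ?A" "bs ! i \<in> ?A" "set as \<subseteq> ?A" "set bs \<subseteq> ?A"
      using nth_mem[of i as] nth_mem[of i bs] by auto
    obtain p q where p: "p permutes B" "as ! i = s \<circ> p" and q: "q permutes B" "bs ! i = s \<circ> q"
      using i by auto
    have offs: "a x = s x" if "a \<in> set as \<or> a \<in> set bs" "x \<notin> B" for a x
      using that i(6,7) off by blast
    have "p y = q y" for y
    proof (cases "y \<in> B")
      case True
      have "(s ^^ Suc i) (p y) = foldr (\<circ>) as id ((s ^^ Suc i) y)"
        using True i(1,2) offs orbit period p permutes_in_image[OF p(1)]
        by (intro foldr_comp_at_orbit[where B = B and k = k, symmetric]) simp_all
      also have "\<dots> = (s ^^ Suc i) (q y)"
        unfolding eq using True i(1,3) offs orbit period q permutes_in_image[OF q(1)]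
        by (intro foldr_comp_at_orbit[where B = B and k = k]) simp_all
      finally show ?thesis using inj by (meson injD)
    next
      case False
      then show ?thesis using p q by (simp add: permutes_not_in)
    qed
    then show "as ! i = bs ! i" using p q by auto
  qed
qed

section \<open>The cyclic shift of blocks\<close>

definition block_shift :: "nat \<Rightarrow> nat \<Rightarrow> nat \<Rightarrow> nat" where
  "block_shift k m x = (if x = 0 \<or> k * m < x then x
     else if x \<le> k * m - m then x + m else x - (k * m - m))"

lemma block_shift_permutes:
  assumes "1 \<le> k" "k * m \<le> n"
  shows "block_shift k m permutes {1..n}"
proof -
  \<comment> \<open>Hiding the product in \<open>q\<close> leaves only linear arithmetic in the case
    analysis.\<close>
  define q where "q = k * m"
  have "m \<le> q" "q \<le> n" using assms by (simp_all add: q_def)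
  then have "inj_on (block_shift k m) {1..n}" "block_shift k m ` {1..n} \<subseteq> {1..n}"
    by (auto simp: inj_on_def block_shift_def simp flip: q_def split: if_splits)
  then have "bij_betw (block_shift k m) {1..n} {1..n}"
    by (simp add: bij_betw_def endo_inj_surj)
  then show ?thesis
    by (rule bij_imp_permutes) (use assms(2) in \<open>auto simp: block_shift_def\<close>)
qed

lemma block_shift_funpow:
  assumes "y \<in> {1..m}" "j < k"
  shows "(block_shift k m ^^ j) y = y + j * m"
  using assms(2)
proof (induction j)
  case (Suc j)
  then have "Suc (Suc j) * m \<le> k * m" by (intro mult_right_mono) auto
  \<comment> \<open>Since \<open>Suc j < k\<close>, the current point is not yet in the last block,
    so no wrap-around occurs.\<close>
  then have "0 < y + j * m" "y + j * m \<le> k * m - m" "y + j * m \<le> k * m"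
    using assms(1) by auto
  then have "block_shift k m (y + j * m) = y + Suc j * m" by (auto simp: block_shift_def)
  then show ?case using Suc by simp
qed simp

lemma block_shift_period:
  assumes "y \<in> {1..m}" "1 \<le> k"
  shows "(block_shift k m ^^ k) y = y"
proof -
  obtain j where j: "k = Suc j" using assms(2) by (cases k) auto
  show ?thesis
    using block_shift_funpow[OF assms(1), of j k] assms(1) unfolding j
    by (simp add: block_shift_def)
qed

lemma fact_div_le_max_S_set:
  assumes "1 \<le> k"
  shows "fact (n div k) \<le> max_S_set k (sym_group n)"
proof -
  define m where "m = n div k"
  have km: "k * m \<le> n" by (simp add: m_def)
  have mn: "m \<le> n" by (simp add: m_def)
  let ?s = "block_shift k m"
  let ?A = "(\<circ>) ?s ` {p. p permutes {1..m}}"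
  have s: "?s permutes {1..n}" using assms km by (rule block_shift_permutes)
  have "S_set (sym_group n) k ?A"
    using s
  proof (rule S_set_shifted_permutations)
    show "{1..m} \<subseteq> {1..n}" using mn by auto
    show "(?s ^^ j) y \<notin> {1..m}" if "y \<in> {1..m}" "0 < j" "j < k" for j y
    proof -
      have "1 * m \<le> j * m" using that by (intro mult_right_mono) auto
      then have "m < y + j * m" using that(1) unfolding atLeastAtMost_iff by linarith
      then show ?thesis using that by (simp add: block_shift_funpow)
    qed
    show "(?s ^^ k) y = y" if "y \<in> {1..m}" for y
      using that assms by (rule block_shift_period)
  qed
  moreover have "finite (carrier (sym_group n))"
    by (simp add: sym_group_def finite_permutations)
  ultimately have "card ?A \<le> max_S_set k (sym_group n)" by (rule card_le_max_S_set[rotated])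
  moreover have "inj_on ((\<circ>) ?s) {p. p permutes {1..m}}"
    using permutes_inj[OF s] by (auto simp: inj_on_def fun_eq_iff)
  then have "card ?A = fact m" by (simp add: card_image card_permutations)
  ultimately show ?thesis by (simp add: m_def)
qed

section \<open>Estimates for factorials\<close>

text \<open>Pair the factor \<open>i\<close> of one factorial with \<open>n + 1 - i\<close> of the
  other; each such product is at least \<open>n\<close>.\<close>

lemma power_self_le_fact_square: "n ^ n \<le> (fact n)\<^sup>2" for n :: nat
proof -
  have "n ^ n = (\<Prod>i=1..n. n)" by simp
  also have "\<dots> \<le> (\<Prod>i=1..n. i * (n + 1 - i))"
  proof (rule prod_mono)
    fix i assume i: "i \<in> {1..n}"
    then obtain b where b: "n = i + b" using le_Suc_ex by auto
    have "1 * b \<le> i * b" using i by (intro mult_right_mono) auto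
    then show "0 \<le> n \<and> n \<le> i * (n + 1 - i)" using b by simp
  qed
  also have "\<dots> = (\<Prod>i=1..n. i) * (\<Prod>i=1..n. n + 1 - i)" by (rule prod.distrib)
  also have "(\<Prod>i=1..n. n + 1 - i) = (\<Prod>i=1..n. i)"
    by (subst prod.atLeastAtMost_rev) simp
  finally show ?thesis by (simp add: fact_prod power2_eq_square)
qed

text \<open>A single term of the exponential series at \<open>m\<close> is at most its sum.\<close>

lemma ln_fact_lower: "real m * ln (real m) - real m \<le> ln (fact m :: real)"
proof (cases "m = 0")
  case False
  have "real m ^ m / fact m \<le> exp (real m)"
    using summable_exp_generic[of "real m"]
    unfolding exp_def
    by (intro order_trans[OF _ sum_le_suminf[of _ "{m}"]]) (auto simp: divide_inverse mult.commute)
  then have "ln (real m ^ m / fact m) \<le> ln (exp (real m))"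
    using False by (subst ln_le_cancel_iff) auto
  then show ?thesis using False by (simp add: ln_div ln_realpow)
qed simp

lemma ln_fact_upper: "ln (fact n :: real) \<le> real n * ln (real n)"
proof (cases "n = 0")
  case False
  have "(fact n :: real) \<le> real n ^ n"
    using fact_le_power[of n] by simp
  then have "ln (fact n :: real) \<le> ln (real n ^ n)" using False by simp
  then show ?thesis using False by (simp add: ln_realpow)
qed simp

text \<open>This converts an error linear in \<open>n\<close> into a multiple of
  \<open>ln (fact n) / ln n\<close>.\<close>

lemma ln_fact_ge_half:
  assumes "n \<ge> 1"
  shows "real n * ln (real n) / 2 \<le> ln (fact n :: real)"
proof -
  have "real (n ^ n) \<le> real ((fact n)\<^sup>2)"
    using power_self_le_fact_square by (rule of_nat_mono)
  then have "real n ^ n \<le> (fact n)\<^sup>2" by simp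
  then have "ln (real n ^ n) \<le> ln ((fact n :: real)\<^sup>2)" using assms by (subst ln_le_cancel_iff) auto
  then show ?thesis using assms by (simp add: ln_realpow)
qed

text \<open>The three summands of the constant pay for rounding \<open>n\<close> down to a multiple
  of \<open>k\<close>, for replacing \<open>ln n\<close> by \<open>ln (n div k)\<close>, and for the
  linear term in \<open>ln_fact_lower\<close>.\<close>

lemma ln_fact_div_ge:
  assumes k: "1 \<le> k" and n: "1 \<le> n"
  shows "ln (fact n :: real) - (real k + ln (2 * real k) + 1) * real n \<le> real k * ln (fact (n div k))"
proof (cases "n < k")
  \<comment> \<open>Here \<open>n div k = 0\<close>, so the right side vanishes and the error term
    has to absorb all of \<open>ln (fact n)\<close>.\<close>
  case True
  have "ln (real n) \<le> ln (2 * real k)" using True n by simp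
  then have "real n * ln (real n) \<le> real n * (real k + ln (2 * real k) + 1)"
    by (intro mult_left_mono) auto
  with ln_fact_upper[of n]
  have "ln (fact n :: real) \<le> real n * (real k + ln (2 * real k) + 1)" by (rule order_trans)
  then show ?thesis using True by (simp add: mult.commute)
next
  case False
  define m where "m = n div k"
  define q r x where "q = real k * real m" and "r = real n" and "x = ln (real m)"
  have m: "1 \<le> m" using False k by (simp add: m_def div_greater_zero_iff Suc_le_eq)
  have nm: "n = k * m + n mod k" by (simp add: m_def)
  moreover have modk: "n mod k < k" using k by simp
  ultimately have "n \<le> k * m + k" by linarith
  moreover have "k * m \<le> n" by (simp add: m_def)
  ultimately have qr: "q \<le> r" "r \<le> q + real k"
    unfolding q_def r_def by (metis of_nat_le_iff of_nat_mult of_nat_add)+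
  have kq: "real k \<le> q" using m k by (simp add: q_def)
  have L: "0 \<le> ln r" "ln r \<le> r" using n ln_le_minus_one[of r] by (auto simp: r_def)
  have K: "0 \<le> ln (2 * real k)" using k by simp
  \<comment> \<open>The factor 2 arises from \<open>r \<le> q + k\<close> and
    \<open>k \<le> q\<close>.\<close>
  have "r \<le> 2 * real k * real m" using qr kq by (simp add: q_def)
  then have "ln r \<le> ln (2 * real k * real m)" using n k m by (simp add: r_def)
  then have x: "ln r - ln (2 * real k) \<le> x" using k m by (simp add: ln_mult x_def)
  have "ln (fact n :: real) \<le> r * ln r" using ln_fact_upper by (simp add: r_def)
  also have "\<dots> \<le> (q + real k) * ln r" using qr L by (intro mult_right_mono) auto
  also have "\<dots> = q * (ln r - ln (2 * real k)) + q * ln (2 * real k) + real k * ln r"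
    by (simp add: algebra_simps)
  also have "\<dots> \<le> q * x + r * ln (2 * real k) + real k * r"
    using x kq qr L K by (intro add_mono mult_left_mono mult_right_mono) auto
  also have "q * x \<le> real k * ln (fact m) + r"
    using mult_left_mono[OF ln_fact_lower[of m], of "real k"] qr
    by (simp add: q_def x_def algebra_simps)
  finally show ?thesis by (simp add: m_def r_def algebra_simps)
qed

theorem theorem1p7:
  fixes k :: nat
  assumes "k \<ge> 1"
  shows "\<exists>C::real. C > 0 \<and> (\<forall>n::nat. n \<ge> 2 \<longrightarrow>
    (fact n :: real) powr (1 / real k - C / ln (real n)) \<le> real (max_S_set k (sym_group n)) \<and>
    real (max_S_set k (sym_group n)) \<le> (fact n :: real) powr (1 / real k + C / ln (real n)))"
proof -
  define D where "D = real k + ln (2 * real k) + 1"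
  have D: "0 < D" using assms by (simp add: D_def add_pos_nonneg)
  show ?thesis
  \<comment> \<open>\<open>D\<close> is the linear error rate of \<open>ln_fact_div_ge\<close>; the
    factor 2 undoes the halving in \<open>ln_fact_ge_half\<close>.\<close>
  proof (intro exI[of _ "2 * D"] conjI allI impI)
    show "0 < 2 * D" using D by simp
  next
    fix n :: nat assume n: "n \<ge> 2"
    let ?M = "max_S_set k (sym_group n)"
    let ?F = "ln (fact n :: real)"
    have lnn: "0 < ln (real n)" using n by simp
    have "?F / real k - D * real n / real k \<le> ln (fact (n div k))"
      using ln_fact_div_ge[of k n] assms n by (simp add: D_def field_simps)
    moreover have "D * real n / real k \<le> D * real n / 1"
      using D assms by (intro divide_left_mono) auto
    moreover have "D * real n \<le> 2 * D / ln (real n) * ?F"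
      using mult_left_mono[OF ln_fact_ge_half[of n], of "2 * D / ln (real n)"] n D lnn
      by simp
    ultimately have "(1 / real k - 2 * D / ln (real n)) * ?F \<le> ln (fact (n div k))"
      by (simp add: algebra_simps)
    then have "(fact n :: real) powr (1 / real k - 2 * D / ln (real n)) \<le> exp (ln (fact (n div k)))"
      by (simp add: powr_def del: exp_ln)
    also have "\<dots> = real (fact (n div k))" by simp
    also have "\<dots> \<le> real ?M" using fact_div_le_max_S_set[OF assms] by (rule of_nat_mono)
    finally show "(fact n :: real) powr (1 / real k - 2 * D / ln (real n)) \<le> real ?M" .
    have fin: "finite (carrier (sym_group n))"
      by (simp add: sym_group_def finite_permutations)
    obtain A where A: "S_set (sym_group n) k A" "card A = ?M"
      using max_S_set_attained[OF fin] by blast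
    have "?M ^ k \<le> card (carrier (sym_group n))"
      using S_set_card_power_le[OF _ fin A(1)] A(2) group.is_monoid[OF sym_group_is_group] by simp
    also have "\<dots> = fact n" by (simp add: sym_group_def card_permutations)
    finally have "real (?M ^ k) \<le> real (fact n)" by (rule of_nat_mono)
    then have "real ?M ^ k \<le> fact n" by simp
    then have "(real ?M ^ k) powr (1 / real k) \<le> fact n powr (1 / real k)"
      by (intro powr_mono2) auto
    \<comment> \<open>The case \<open>?M = 0\<close> is separate because \<open>powr_realpow\<close>
      requires a positive base.\<close>
    moreover have "(real ?M ^ k) powr (1 / real k) = real ?M"
      using assms by (cases "?M = 0") (auto simp: powr_realpow[symmetric] powr_powr)
    ultimately have "real ?M \<le> fact n powr (1 / real k)" by simp
    also have "\<dots> \<le> fact n powr (1 / real k + 2 * D / ln (real n))"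
      using D lnn by (intro powr_mono) auto
    finally show "real ?M \<le> fact n powr (1 / real k + 2 * D / ln (real n))" .
  qed
qed

end
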